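(* S1S$[E]$ is strictly more expressive than HyperQPTL: every HyperQPTL formula over $AP$ has an equivalent closed S1S$[E]$ formula (satisfied by exactly the same trace sets $T\subseteq(2^{AP})^\omega$), but some closed S1S$[E]$ formula has no equivalent HyperQPTL formula.
   Context: Traces are $t\in(2^{AP})^\omega$, $t[i]$ the $i$-th element. HyperQPTL syntax: $\varphi ::= \forall\pi.\varphi \mid \exists\pi.\varphi \mid \exists q.\varphi \mid \forall q.\varphi \mid \psi$, $\psi ::= a_\pi \mid q \mid \neg\psi \mid \psi\vee\psi \mid \mathsf{X}\psi \mid \psi\,\mathsf{U}\,\psi$ (prenex quantifiers; $\pi$ trace variables, $q$ propositional variables). Semantics over a trace set $T$, assignment $\Pi$ (trace variables to traces of $T$, propositional variable $q$ to a trace in $(2^{\{q\}})^\omega$), position $i$: $a_\pi$ holds iff $a\in\Pi(\pi)[i]$; $q$ holds iff $q\in\Pi(q)[i]$; $\mathsf X$, $\mathsf U$, Boolean connectives as in LTL; $\exists\pi$ ranges over $T$, $\exists q$ over $(2^{\{q\}})^\omega$; universal quantifiers dual; $T\models\varphi$ iff $\emptyset,0\models_T\varphi$. S1S$[E]$: terms $\tau ::= x \mid min(x) \mid S(\tau)$; formulas $\varphi ::= \tau\in X \mid \tau=\tau \mid E(\tau,\tau) \mid \neg\varphi\mid\varphi\vee\varphi\mid\exists x.\varphi\mid\exists X.\varphi$, with free set variables $X_a$ ($a\in AP$). Over $T$, first-order variables range over $T\times\mathbb N$, second-order over subsets of it; $[min(x)]=(t,0)$ if $x=(t,n)$; $[S(\tau)]=(t,n+1)$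 if $[\tau]=(t,n)$; $E(\tau_1,\tau_2)$ iff second components of $[\tau_1],[\tau_2]$ coincide. Closed formulas have only the $X_a$ free; $T\models\varphi$ iff $\varphi$ holds with $X_a=\{(t,n)\in T\times\mathbb N\mid a\in t[n]\}$. *)

theory Defs
  imports Main
begin

text \<open>
  The type variable \<open>'a\<close> plays the role of the set \<open>AP\<close> of atomic propositions, so that
  \<open>'a trace\<close> is the set of all traces over \<open>AP\<close>. As types are inhabited, \<open>AP\<close> is nonempty
  (over an empty \<open>AP\<close> the only trace sets are the empty set and one singleton, and
  HyperQPTL already tells them apart); it may be finite or infinite.
\<close>

type_synonym 'p trace = "nat \<Rightarrow> 'p set"

definition traces_over :: "'p set \<Rightarrow> 'p trace set" where
  "traces_over P = {t. \<forall>i. t i \<subseteq> P}"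


section \<open>HyperQPTL\<close>

type_synonym tvar = nat
type_synonym pvar = nat

datatype 'a qptl =
    Atom 'a tvar
  | PVar pvar
  | Neg "'a qptl"
  | Disj "'a qptl" "'a qptl"
  | Next "'a qptl"
  | Until "'a qptl" "'a qptl"

datatype 'a hyperqptl =
    ForallTrace tvar "'a hyperqptl"
  | ExistsTrace tvar "'a hyperqptl"
  | ExistsProp pvar "'a hyperqptl"
  | ForallProp pvar "'a hyperqptl"
  | Body "'a qptl"

text \<open>
  The assignment is kept as two partial maps, one for each sort of variables. A propositional
  variable \<open>q\<close> is assigned a trace over \<open>{q}\<close>. Undefined variables are only looked up in
  formulas that are not closed.
\<close>

fun sat_qptl :: "(tvar \<rightharpoonup> 'a trace) \<Rightarrow> (pvar \<rightharpoonup> pvar trace) \<Rightarrow> nat \<Rightarrow> 'a qptl \<Rightarrow> bool" where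
  "sat_qptl \<Pi> \<Theta> i (Atom a \<pi>) \<longleftrightarrow> a \<in> the (\<Pi> \<pi>) i"
| "sat_qptl \<Pi> \<Theta> i (PVar q) \<longleftrightarrow> q \<in> the (\<Theta> q) i"
| "sat_qptl \<Pi> \<Theta> i (Neg \<psi>) \<longleftrightarrow> \<not> sat_qptl \<Pi> \<Theta> i \<psi>"
| "sat_qptl \<Pi> \<Theta> i (Disj \<psi>1 \<psi>2) \<longleftrightarrow> sat_qptl \<Pi> \<Theta> i \<psi>1 \<or> sat_qptl \<Pi> \<Theta> i \<psi>2"
| "sat_qptl \<Pi> \<Theta> i (Next \<psi>) \<longleftrightarrow> sat_qptl \<Pi> \<Theta> (Suc i) \<psi>"
| "sat_qptl \<Pi> \<Theta> i (Until \<psi>1 \<psi>2) \<longleftrightarrow>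
     (\<exists>j\<ge>i. sat_qptl \<Pi> \<Theta> j \<psi>2 \<and> (\<forall>k. i \<le> k \<and> k < j \<longrightarrow> sat_qptl \<Pi> \<Theta> k \<psi>1))"

fun sat_hyperqptl ::
  "'a trace set \<Rightarrow> (tvar \<rightharpoonup> 'a trace) \<Rightarrow> (pvar \<rightharpoonup> pvar trace) \<Rightarrow> nat \<Rightarrow> 'a hyperqptl \<Rightarrow> bool" where
  "sat_hyperqptl T \<Pi> \<Theta> i (ForallTrace \<pi> \<phi>) \<longleftrightarrow> (\<forall>t\<in>T. sat_hyperqptl T (\<Pi>(\<pi> \<mapsto> t)) \<Theta> i \<phi>)"
| "sat_hyperqptl T \<Pi> \<Theta> i (ExistsTrace \<pi> \<phi>) \<longleftrightarrow> (\<exists>t\<in>T. sat_hyperqptl T (\<Pi>(\<pi> \<mapsto> t)) \<Theta> i \<phi>)"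
| "sat_hyperqptl T \<Pi> \<Theta> i (ExistsProp q \<phi>) \<longleftrightarrow>
     (\<exists>t\<in>traces_over {q}. sat_hyperqptl T \<Pi> (\<Theta>(q \<mapsto> t)) i \<phi>)"
| "sat_hyperqptl T \<Pi> \<Theta> i (ForallProp q \<phi>) \<longleftrightarrow>
     (\<forall>t\<in>traces_over {q}. sat_hyperqptl T \<Pi> (\<Theta>(q \<mapsto> t)) i \<phi>)"
| "sat_hyperqptl T \<Pi> \<Theta> i (Body \<psi>) \<longleftrightarrow> sat_qptl \<Pi> \<Theta> i \<psi>"

fun tvars_qptl :: "'a qptl \<Rightarrow> tvar set" where
  "tvars_qptl (Atom a \<pi>) = {\<pi>}"
| "tvars_qptl (PVar q) = {}"
| "tvars_qptl (Neg \<psi>) = tvars_qptl \<psi>"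
| "tvars_qptl (Disj \<psi>1 \<psi>2) = tvars_qptl \<psi>1 \<union> tvars_qptl \<psi>2"
| "tvars_qptl (Next \<psi>) = tvars_qptl \<psi>"
| "tvars_qptl (Until \<psi>1 \<psi>2) = tvars_qptl \<psi>1 \<union> tvars_qptl \<psi>2"

fun pvars_qptl :: "'a qptl \<Rightarrow> pvar set" where
  "pvars_qptl (Atom a \<pi>) = {}"
| "pvars_qptl (PVar q) = {q}"
| "pvars_qptl (Neg \<psi>) = pvars_qptl \<psi>"
| "pvars_qptl (Disj \<psi>1 \<psi>2) = pvars_qptl \<psi>1 \<union> pvars_qptl \<psi>2"
| "pvars_qptl (Next \<psi>) = pvars_qptl \<psi>"
| "pvars_qptl (Until \<psi>1 \<psi>2) = pvars_qptl \<psi>1 \<union> pvars_qptl \<psi>2"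

fun free_tvars :: "'a hyperqptl \<Rightarrow> tvar set" where
  "free_tvars (ForallTrace \<pi> \<phi>) = free_tvars \<phi> - {\<pi>}"
| "free_tvars (ExistsTrace \<pi> \<phi>) = free_tvars \<phi> - {\<pi>}"
| "free_tvars (ExistsProp q \<phi>) = free_tvars \<phi>"
| "free_tvars (ForallProp q \<phi>) = free_tvars \<phi>"
| "free_tvars (Body \<psi>) = tvars_qptl \<psi>"

fun free_pvars :: "'a hyperqptl \<Rightarrow> pvar set" where
  "free_pvars (ForallTrace \<pi> \<phi>) = free_pvars \<phi>"
| "free_pvars (ExistsTrace \<pi> \<phi>) = free_pvars \<phi>"
| "free_pvars (ExistsProp q \<phi>) = free_pvars \<phi> - {q}"
| "free_pvars (ForallProp q \<phi>) = free_pvars \<phi> - {q}"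
| "free_pvars (Body \<psi>) = pvars_qptl \<psi>"

definition closed_hyperqptl :: "'a hyperqptl \<Rightarrow> bool" where
  "closed_hyperqptl \<phi> \<longleftrightarrow> free_tvars \<phi> = {} \<and> free_pvars \<phi> = {}"

definition models_hyperqptl :: "'a trace set \<Rightarrow> 'a hyperqptl \<Rightarrow> bool"  (infix "\<Turnstile>\<^sub>Q" 50) where
  "T \<Turnstile>\<^sub>Q \<phi> \<longleftrightarrow> sat_hyperqptl T Map.empty Map.empty 0 \<phi>"


section \<open>S1S[E]\<close>

type_synonym fovar = nat

text \<open>\<open>XAP a\<close> is the distinguished set variable \<open>X\<^sub>a\<close>.\<close>

datatype 'a sovar = XAP 'a | SOVar nat

datatype fo_term = FOVar fovar | MinOf fovar | Succ fo_term

datatype 'a s1se =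
    Mem fo_term "'a sovar"
  | Eq fo_term fo_term
  | EqLevel fo_term fo_term
  | SNeg "'a s1se"
  | SDisj "'a s1se" "'a s1se"
  | ExistsFO fovar "'a s1se"
  | ExistsSO "'a sovar" "'a s1se"

fun eval_term :: "(fovar \<rightharpoonup> 'a trace \<times> nat) \<Rightarrow> fo_term \<Rightarrow> 'a trace \<times> nat" where
  "eval_term V (FOVar x) = the (V x)"
| "eval_term V (MinOf x) = (fst (the (V x)), 0)"
| "eval_term V (Succ \<tau>) = (fst (eval_term V \<tau>), Suc (snd (eval_term V \<tau>)))"

fun sat_s1se ::
  "'a trace set \<Rightarrow> (fovar \<rightharpoonup> 'a trace \<times> nat) \<Rightarrow> ('a sovar \<rightharpoonup> ('a trace \<times> nat) set) \<Rightarrow> 'a s1se \<Rightarrow> bool"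
where
  "sat_s1se T V W (Mem \<tau> X) \<longleftrightarrow> eval_term V \<tau> \<in> the (W X)"
| "sat_s1se T V W (Eq \<tau>1 \<tau>2) \<longleftrightarrow> eval_term V \<tau>1 = eval_term V \<tau>2"
| "sat_s1se T V W (EqLevel \<tau>1 \<tau>2) \<longleftrightarrow> snd (eval_term V \<tau>1) = snd (eval_term V \<tau>2)"
| "sat_s1se T V W (SNeg \<phi>) \<longleftrightarrow> \<not> sat_s1se T V W \<phi>"
| "sat_s1se T V W (SDisj \<phi>1 \<phi>2) \<longleftrightarrow> sat_s1se T V W \<phi>1 \<or> sat_s1se T V W \<phi>2"
| "sat_s1se T V W (ExistsFO x \<phi>) \<longleftrightarrow> (\<exists>p \<in> T \<times> UNIV. sat_s1se T (V(x \<mapsto> p)) W \<phi>)"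
| "sat_s1se T V W (ExistsSO X \<phi>) \<longleftrightarrow> (\<exists>A. A \<subseteq> T \<times> UNIV \<and> sat_s1se T V (W(X \<mapsto> A)) \<phi>)"

fun fovars_term :: "fo_term \<Rightarrow> fovar set" where
  "fovars_term (FOVar x) = {x}"
| "fovars_term (MinOf x) = {x}"
| "fovars_term (Succ \<tau>) = fovars_term \<tau>"

fun free_fovars :: "'a s1se \<Rightarrow> fovar set" where
  "free_fovars (Mem \<tau> X) = fovars_term \<tau>"
| "free_fovars (Eq \<tau>1 \<tau>2) = fovars_term \<tau>1 \<union> fovars_term \<tau>2"
| "free_fovars (EqLevel \<tau>1 \<tau>2) = fovars_term \<tau>1 \<union> fovars_term \<tau>2"
| "free_fovars (SNeg \<phi>) = free_fovars \<phi>"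
| "free_fovars (SDisj \<phi>1 \<phi>2) = free_fovars \<phi>1 \<union> free_fovars \<phi>2"
| "free_fovars (ExistsFO x \<phi>) = free_fovars \<phi> - {x}"
| "free_fovars (ExistsSO X \<phi>) = free_fovars \<phi>"

fun free_sovars :: "'a s1se \<Rightarrow> 'a sovar set" where
  "free_sovars (Mem \<tau> X) = {X}"
| "free_sovars (Eq \<tau>1 \<tau>2) = {}"
| "free_sovars (EqLevel \<tau>1 \<tau>2) = {}"
| "free_sovars (SNeg \<phi>) = free_sovars \<phi>"
| "free_sovars (SDisj \<phi>1 \<phi>2) = free_sovars \<phi>1 \<union> free_sovars \<phi>2"
| "free_sovars (ExistsFO x \<phi>) = free_sovars \<phi>"
| "free_sovars (ExistsSO X \<phi>) = free_sovars \<phi> - {X}"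

definition closed_s1se :: "'a s1se \<Rightarrow> bool" where
  "closed_s1se \<phi> \<longleftrightarrow> free_fovars \<phi> = {} \<and> free_sovars \<phi> \<subseteq> range XAP"

fun ap_valuation :: "'a trace set \<Rightarrow> 'a sovar \<rightharpoonup> ('a trace \<times> nat) set" where
  "ap_valuation T (XAP a) = Some {(t, n) \<in> T \<times> UNIV. a \<in> t n}"
| "ap_valuation T (SOVar X) = None"

definition models_s1se :: "'a trace set \<Rightarrow> 'a s1se \<Rightarrow> bool"  (infix "\<Turnstile>\<^sub>S" 50) where
  "T \<Turnstile>\<^sub>S \<phi> \<longleftrightarrow> sat_s1se T Map.empty (ap_valuation T) \<phi>"

end

theory Submission
  imports Defs
begin

text \<open>
  HyperQPTL embeds into S1S[E] by guessing a propositional variable as a subset of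
  \<open>T \<times> \<nat>\<close> of which only the projection to \<open>\<nat>\<close> matters, and by describing an until as a least fixed
  point. As the domain of S1S[E] is empty if \<open>T\<close> is, the constant truth value of
  the formula on the empty trace set has to be treated separately.

  For strictness, S1S[E] can say of a finite \<open>T\<close> that its cardinality is a perfect square, by
  guessing two functions \<open>T \<rightarrow> \<nat>\<close> that together are a bijection between \<open>T\<close> and some \<open>R \<times> R\<close>. Let \<open>T\<^sub>n\<close>
  consist of the traces that carry all propositions at one position \<open>k < n\<close> and none elsewhere.
  On these sets a HyperQPTL formula only speaks about the \<open>\<omega>\<close>-word that marks the positions below
  \<open>n\<close>. The words satisfying it are a union of classes of an equivalence relation of finite index
  that is stable under prepending letters, so the set of all \<open>n\<close> such that \<open>T\<^sub>n\<close> satisfies the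
  formula is ultimately periodic, unlike the set of squares.
\<close>

section \<open>Derived connectives of S1S[E]\<close>

definition SConj :: "'a s1se \<Rightarrow> 'a s1se \<Rightarrow> 'a s1se" where
  "SConj \<phi> \<psi> = SNeg (SDisj (SNeg \<phi>) (SNeg \<psi>))"

definition SImp :: "'a s1se \<Rightarrow> 'a s1se \<Rightarrow> 'a s1se" where
  "SImp \<phi> \<psi> = SDisj (SNeg \<phi>) \<psi>"

definition ForallFO :: "fovar \<Rightarrow> 'a s1se \<Rightarrow> 'a s1se" where
  "ForallFO x \<phi> = SNeg (ExistsFO x (SNeg \<phi>))"

definition ForallSO :: "'a sovar \<Rightarrow> 'a s1se \<Rightarrow> 'a s1se" where
  "ForallSO X \<phi> = SNeg (ExistsSO X (SNeg \<phi>))"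

lemma sat_derived [simp]:
  "sat_s1se T V W (SConj \<phi> \<psi>) \<longleftrightarrow> sat_s1se T V W \<phi> \<and> sat_s1se T V W \<psi>"
  "sat_s1se T V W (SImp \<phi> \<psi>) \<longleftrightarrow> (sat_s1se T V W \<phi> \<longrightarrow> sat_s1se T V W \<psi>)"
  "sat_s1se T V W (ForallFO x \<phi>) \<longleftrightarrow> (\<forall>p \<in> T \<times> UNIV. sat_s1se T (V(x \<mapsto> p)) W \<phi>)"
  "sat_s1se T V W (ForallSO X \<phi>) \<longleftrightarrow> (\<forall>A. A \<subseteq> T \<times> UNIV \<longrightarrow> sat_s1se T V (W(X \<mapsto> A)) \<phi>)"
  by (auto simp: SConj_def SImp_def ForallFO_def ForallSO_def)

lemma free_derived [simp]:
  "free_fovars (SConj \<phi> \<psi>) = free_fovars \<phi> \<union> free_fovars \<psi>"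
  "free_fovars (SImp \<phi> \<psi>) = free_fovars \<phi> \<union> free_fovars \<psi>"
  "free_fovars (ForallFO x \<phi>) = free_fovars \<phi> - {x}"
  "free_fovars (ForallSO X \<phi>) = free_fovars \<phi>"
  "free_sovars (SConj \<phi> \<psi>) = free_sovars \<phi> \<union> free_sovars \<psi>"
  "free_sovars (SImp \<phi> \<psi>) = free_sovars \<phi> \<union> free_sovars \<psi>"
  "free_sovars (ForallFO x \<phi>) = free_sovars \<phi>"
  "free_sovars (ForallSO X \<phi>) = free_sovars \<phi> - {X}"
  by (auto simp: SConj_def SImp_def ForallFO_def ForallSO_def)


section \<open>Translating HyperQPTL to S1S[E]\<close>

text \<open>Even numbers are for the variables of the HyperQPTL formula, odd ones for auxiliary
  variables indexed by nesting depth. The same split serves first-order and set variables, so no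
  capture can occur.\<close>

definition qvar :: "nat \<Rightarrow> nat" where
  "qvar v = 2 * v"

definition aux :: "nat \<Rightarrow> nat" where
  "aux p = 2 * p + 1"

lemma qvar_aux [simp]:
  "qvar v = qvar v' \<longleftrightarrow> v = v'"
  "aux p = aux p' \<longleftrightarrow> p = p'"
  "qvar v \<noteq> aux p"
  "aux p \<noteq> qvar v"
  unfolding qvar_def aux_def by presburger+

text \<open>The first-order variable \<open>aux p\<close> holds the current position, on an arbitrary trace.\<close>

fun s1se_of_qptl :: "nat \<Rightarrow> 'a qptl \<Rightarrow> 'a s1se" where
  "s1se_of_qptl p (Atom a \<pi>) =
     ExistsFO (aux (Suc p)) (SConj (Eq (MinOf (aux (Suc p))) (MinOf (qvar \<pi>)))
       (SConj (EqLevel (FOVar (aux (Suc p))) (FOVar (aux p))) (Mem (FOVar (aux (Suc p))) (XAP a))))"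
| "s1se_of_qptl p (PVar q) =
     ExistsFO (aux (Suc p)) (SConj (EqLevel (FOVar (aux (Suc p))) (FOVar (aux p)))
       (Mem (FOVar (aux (Suc p))) (SOVar (qvar q))))"
| "s1se_of_qptl p (Neg \<psi>) = SNeg (s1se_of_qptl p \<psi>)"
| "s1se_of_qptl p (Disj \<psi>1 \<psi>2) = SDisj (s1se_of_qptl p \<psi>1) (s1se_of_qptl p \<psi>2)"
| "s1se_of_qptl p (Next \<psi>) =
     ExistsFO (aux (Suc p)) (SConj (Eq (FOVar (aux (Suc p))) (Succ (FOVar (aux p))))
       (s1se_of_qptl (Suc p) \<psi>))"
| "s1se_of_qptl p (Until \<psi>1 \<psi>2) =
     ForallSO (SOVar (aux p)) (SImp
       (ForallFO (aux (Suc p)) (SImp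
         (SDisj (s1se_of_qptl (Suc p) \<psi>2)
           (SConj (s1se_of_qptl (Suc p) \<psi>1)
             (Mem (Succ (FOVar (aux (Suc p)))) (SOVar (aux p)))))
         (Mem (FOVar (aux (Suc p))) (SOVar (aux p)))))
       (Mem (FOVar (aux p)) (SOVar (aux p))))"

text \<open>A trace variable becomes a first-order variable of which only the trace is ever read,
  through \<open>MinOf\<close>. The body starts at position 0 of some trace, so this clause is false
  on the empty trace set.\<close>

fun s1se_of_hyperqptl :: "'a hyperqptl \<Rightarrow> 'a s1se" where
  "s1se_of_hyperqptl (ForallTrace \<pi> \<phi>) = ForallFO (qvar \<pi>) (s1se_of_hyperqptl \<phi>)"
| "s1se_of_hyperqptl (ExistsTrace \<pi> \<phi>) = ExistsFO (qvar \<pi>) (s1se_of_hyperqptl \<phi>)"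
| "s1se_of_hyperqptl (ExistsProp q \<phi>) = ExistsSO (SOVar (qvar q)) (s1se_of_hyperqptl \<phi>)"
| "s1se_of_hyperqptl (ForallProp q \<phi>) = ForallSO (SOVar (qvar q)) (s1se_of_hyperqptl \<phi>)"
| "s1se_of_hyperqptl (Body \<psi>) =
     ExistsFO (aux 0) (SConj (Eq (FOVar (aux 0)) (MinOf (aux 0))) (s1se_of_qptl 0 \<psi>))"

lemma free_s1se_of_qptl:
  "free_fovars (s1se_of_qptl p \<psi>) \<subseteq> insert (aux p) (qvar ` tvars_qptl \<psi>)"
  "free_sovars (s1se_of_qptl p \<psi>) \<subseteq> range XAP \<union> (\<lambda>q. SOVar (qvar q)) ` pvars_qptl \<psi>"
  by (induction \<psi> arbitrary: p) (fastforce simp: subset_iff)+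

lemma free_s1se_of_hyperqptl:
  "free_fovars (s1se_of_hyperqptl \<phi>) \<subseteq> qvar ` free_tvars \<phi>"
  "free_sovars (s1se_of_hyperqptl \<phi>) \<subseteq> range XAP \<union> (\<lambda>q. SOVar (qvar q)) ` free_pvars \<phi>"
proof (induction \<phi>)
  case (Body \<psi>)
  { case 1 then show ?case using free_s1se_of_qptl(1)[of 0 \<psi>] by auto }
  { case 2 then show ?case using free_s1se_of_qptl(2)[of 0 \<psi>] by auto }
qed auto

section \<open>Correctness of the translation\<close>

definition encodes_prop :: "'a trace set \<Rightarrow> pvar \<Rightarrow> pvar trace \<Rightarrow> ('a trace \<times> nat) set \<Rightarrow> bool" where
  "encodes_prop T q t A \<longleftrightarrow> (\<forall>i. q \<in> t i \<longleftrightarrow> (\<exists>s\<in>T. (s, i) \<in> A))"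

text \<open>The invariant of the inductions. It leaves the position stored for a trace variable open
  and constrains only the variables in \<open>P\<close> and \<open>Q\<close>, which shrink on
  passing to subformulas and grow under quantifiers.\<close>

definition compatible ::
  "'a trace set \<Rightarrow> tvar set \<Rightarrow> pvar set \<Rightarrow> (tvar \<rightharpoonup> 'a trace) \<Rightarrow> (pvar \<rightharpoonup> pvar trace) \<Rightarrow>
    (fovar \<rightharpoonup> 'a trace \<times> nat) \<Rightarrow> ('a sovar \<rightharpoonup> ('a trace \<times> nat) set) \<Rightarrow> bool"
where
  "compatible T P Q \<Pi> \<Theta> V W \<longleftrightarrow>
     (\<forall>\<pi>\<in>P. the (\<Pi> \<pi>) \<in> T \<and> fst (the (V (qvar \<pi>))) = the (\<Pi> \<pi>)) \<and>
     (\<forall>q\<in>Q. encodes_prop T q (the (\<Theta> q)) (the (W (SOVar (qvar q))))) \<and>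
     (\<forall>a. the (W (XAP a)) = {(t, n) \<in> T \<times> UNIV. a \<in> t n})"

lemma compatible_mono:
  "compatible T P Q \<Pi> \<Theta> V W \<Longrightarrow> P' \<subseteq> P \<Longrightarrow> Q' \<subseteq> Q \<Longrightarrow> compatible T P' Q' \<Pi> \<Theta> V W"
  by (auto simp: compatible_def)

lemma compatible_aux [simp]:
  "compatible T P Q \<Pi> \<Theta> (V(aux p \<mapsto> x)) W = compatible T P Q \<Pi> \<Theta> V W"
  "compatible T P Q \<Pi> \<Theta> V (W(SOVar (aux p) \<mapsto> A)) = compatible T P Q \<Pi> \<Theta> V W"
  by (auto simp: compatible_def)

text \<open>The expansion law serves twice: as the fixed-point equation behind the translation of
  until, and as the rule that decides until on a word after a letter is prepended.\<close>

lemma sat_qptl_until_unfold: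
  "sat_qptl \<Pi> \<Theta> i (Until \<psi>1 \<psi>2) \<longleftrightarrow>
     sat_qptl \<Pi> \<Theta> i \<psi>2 \<or> sat_qptl \<Pi> \<Theta> i \<psi>1 \<and> sat_qptl \<Pi> \<Theta> (Suc i) (Until \<psi>1 \<psi>2)"
  (is "?U i \<longleftrightarrow> ?Q i \<or> ?P i \<and> ?U (Suc i)")
proof
  assume "?U i"
  then obtain j where j: "i \<le> j" "?Q j" "\<And>k. i \<le> k \<Longrightarrow> k < j \<Longrightarrow> ?P k" by auto
  show "?Q i \<or> ?P i \<and> ?U (Suc i)"
  proof (cases "i = j")
    case False
    with j have "?P i" "Suc i \<le> j" "\<And>k. Suc i \<le> k \<Longrightarrow> k < j \<Longrightarrow> ?P k" by auto
    with j(2) show ?thesis by auto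
  qed (use j in auto)
next
  assume "?Q i \<or> ?P i \<and> ?U (Suc i)"
  then show "?U i"
  proof
    assume *: "?P i \<and> ?U (Suc i)"
    then obtain j where j: "Suc i \<le> j" "?Q j" "\<And>k. Suc i \<le> k \<Longrightarrow> k < j \<Longrightarrow> ?P k" by auto
    have "?P k" if "i \<le> k" "k < j" for k
      using * j(3)[of k] that by (cases "k = i") auto
    with j(1,2) show ?thesis by (auto intro!: exI[of _ j])
  qed auto
qed

lemma sat_s1se_of_qptl:
  assumes "compatible T (tvars_qptl \<psi>) (pvars_qptl \<psi>) \<Pi> \<Theta> V W"
    and "V (aux p) = Some (t, i)" and "t \<in> T"
  shows "sat_s1se T V W (s1se_of_qptl p \<psi>) \<longleftrightarrow> sat_qptl \<Pi> \<Theta> i \<psi>"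
  using assms
proof (induction \<psi> arbitrary: p t i V W)
  case (Atom a \<pi>)
  then show ?case by (auto simp: compatible_def)
next
  case (PVar q)
  then show ?case by (auto simp: compatible_def encodes_prop_def)
next
  case (Neg \<psi>)
  then show ?case by simp
next
  case (Disj \<psi>1 \<psi>2)
  then have "compatible T (tvars_qptl \<psi>1) (pvars_qptl \<psi>1) \<Pi> \<Theta> V W"
    "compatible T (tvars_qptl \<psi>2) (pvars_qptl \<psi>2) \<Pi> \<Theta> V W"
    by (auto elim: compatible_mono)
  with Disj show ?case by simp
next
  case (Next \<psi>)
  have c: "compatible T (tvars_qptl \<psi>) (pvars_qptl \<psi>) \<Pi> \<Theta> (V(aux (Suc p) \<mapsto> (t, Suc i))) W"
    using Next.prems(1) by simp
  have "sat_s1se T (V(aux (Suc p) \<mapsto> (t, Suc i))) W (s1se_of_qptl (Suc p) \<psi>)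
      \<longleftrightarrow> sat_qptl \<Pi> \<Theta> (Suc i) \<psi>"
    using c \<open>t \<in> T\<close> by (intro Next.IH[OF c]) simp_all
  then show ?case using Next.prems by auto
next
  case (Until \<psi>1 \<psi>2)
  let ?V = "\<lambda>x. V(aux (Suc p) \<mapsto> x)" and ?W = "\<lambda>A. W(SOVar (aux p) \<mapsto> A)"
  have c: "compatible T (tvars_qptl \<psi>1) (pvars_qptl \<psi>1) \<Pi> \<Theta> (?V x) (?W A)"
    "compatible T (tvars_qptl \<psi>2) (pvars_qptl \<psi>2) \<Pi> \<Theta> (?V x) (?W A)" for x A
    using Until.prems(1) by (simp_all add: compatible_mono)
  have 1: "sat_s1se T (?V (s, j)) (?W A) (s1se_of_qptl (Suc p) \<psi>1) \<longleftrightarrow> sat_qptl \<Pi> \<Theta> j \<psi>1"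
    if "s \<in> T" for s j A
    by (rule Until.IH(1)[OF c(1) _ that]) simp
  have 2: "sat_s1se T (?V (s, j)) (?W A) (s1se_of_qptl (Suc p) \<psi>2) \<longleftrightarrow> sat_qptl \<Pi> \<Theta> j \<psi>2"
    if "s \<in> T" for s j A
    by (rule Until.IH(2)[OF c(2) _ that]) simp
  \<comment> \<open>The prefixed points of the expansion law, on all traces of \<open>T\<close> at
    once. The translated until asks that \<open>(t, i)\<close> lie in each of them, hence in the
    least one.\<close>
  define closed_under where "closed_under A \<longleftrightarrow> (\<forall>s\<in>T. \<forall>j. sat_qptl \<Pi> \<Theta> j \<psi>2 \<or>
      (sat_qptl \<Pi> \<Theta> j \<psi>1 \<and> (s, Suc j) \<in> A) \<longrightarrow> (s, j) \<in> A)" for A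
  have "sat_s1se T V W (s1se_of_qptl p (Until \<psi>1 \<psi>2)) \<longleftrightarrow>
      (\<forall>A. A \<subseteq> T \<times> UNIV \<longrightarrow> closed_under A \<longrightarrow> (t, i) \<in> A)"
    using Until.prems(2) by (simp add: 1 2 closed_under_def cong: conj_cong)
  also have "\<dots> \<longleftrightarrow> sat_qptl \<Pi> \<Theta> i (Until \<psi>1 \<psi>2)"
  proof
    assume *: "\<forall>A. A \<subseteq> T \<times> UNIV \<longrightarrow> closed_under A \<longrightarrow> (t, i) \<in> A"
    \<comment> \<open>The solution set of until is itself a prefixed point, so it can instantiate
      the universally quantified set.\<close>
    define A where "A = {(s, j). s \<in> T \<and> sat_qptl \<Pi> \<Theta> j (Until \<psi>1 \<psi>2)}"
    have "closed_under A"
      unfolding closed_under_def A_def using sat_qptl_until_unfold by blast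
    moreover have "A \<subseteq> T \<times> UNIV" by (auto simp: A_def)
    ultimately have "(t, i) \<in> A" using * by blast
    then show "sat_qptl \<Pi> \<Theta> i (Until \<psi>1 \<psi>2)" by (simp add: A_def)
  next
    assume "sat_qptl \<Pi> \<Theta> i (Until \<psi>1 \<psi>2)"
    then obtain j where j: "i \<le> j" "sat_qptl \<Pi> \<Theta> j \<psi>2"
      "\<And>k. i \<le> k \<Longrightarrow> k < j \<Longrightarrow> sat_qptl \<Pi> \<Theta> k \<psi>1"
      by auto
    show "\<forall>A. A \<subseteq> T \<times> UNIV \<longrightarrow> closed_under A \<longrightarrow> (t, i) \<in> A"
    proof (intro allI impI)
      fix A assume A: "closed_under A"
      \<comment> \<open>Descend from the witness \<open>j\<close> to \<open>i\<close>: \<psi>2 puts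
        \<open>j\<close> into \<open>A\<close>, and \<psi>1 carries membership from each position to
        the one before.\<close>
      from j(1) show "(t, i) \<in> A"
      proof (induction rule: inc_induct)
        case base
        then show ?case using A j(2) \<open>t \<in> T\<close> by (auto simp: closed_under_def)
      next
        case (step k)
        then show ?case using A j(3) \<open>t \<in> T\<close> by (auto simp: closed_under_def)
      qed
    qed
  qed
  finally show ?case .
qed

lemma compatible_trace:
  assumes "compatible T (P - {\<pi>}) Q \<Pi> \<Theta> V W" and "t \<in> T"
  shows "compatible T P Q (\<Pi>(\<pi> \<mapsto> t)) \<Theta> (V(qvar \<pi> \<mapsto> (t, n))) W"
  using assms by (auto simp: compatible_def)

lemma compatible_prop:
  assumes "compatible T P (Q - {q}) \<Pi> \<Theta> V W" and "encodes_prop T q t A"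
  shows "compatible T P Q \<Pi> (\<Theta>(q \<mapsto> t)) V (W(SOVar (qvar q) \<mapsto> A))"
  using assms by (auto simp: compatible_def)

text \<open>Over an empty \<open>T\<close> only the empty set is available, which encodes a
  proposition that never holds; any trace in \<open>T\<close> can carry the other values.\<close>

lemma ex_encodes_prop_set:
  assumes "T \<noteq> {}"
  shows "\<exists>A. A \<subseteq> T \<times> UNIV \<and> encodes_prop T q t A"
  using assms by (intro exI[of _ "T \<times> {i. q \<in> t i}"]) (auto simp: encodes_prop_def)

lemma ex_encodes_prop_trace: "\<exists>t\<in>traces_over {q}. encodes_prop T q t A"
  by (rule bexI[of _ "\<lambda>i. {r. r = q \<and> (\<exists>s\<in>T. (s, i) \<in> A)}"])
    (auto simp: encodes_prop_def traces_over_def)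

text \<open>Many sets encode the same trace, so there is no bijection to transport the quantifier
  along. It suffices that each side has a partner on the other and that the properties agree on
  partners.\<close>

lemma ex_encodes_prop_iff:
  assumes "T \<noteq> {}" and "\<And>t A. encodes_prop T q t A \<Longrightarrow> P A \<longleftrightarrow> R t"
  shows "(\<exists>A. A \<subseteq> T \<times> UNIV \<and> P A) \<longleftrightarrow> (\<exists>t\<in>traces_over {q}. R t)"
proof
  assume "\<exists>A. A \<subseteq> T \<times> UNIV \<and> P A"
  then obtain A where "P A" by blast
  moreover obtain t where "t \<in> traces_over {q}" "encodes_prop T q t A"
    using ex_encodes_prop_trace by blast
  ultimately show "\<exists>t\<in>traces_over {q}. R t" using assms(2) by blast
next
  assume "\<exists>t\<in>traces_over {q}. R t"
  then obtain t where "R t" by blast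
  moreover obtain A where "A \<subseteq> T \<times> UNIV" "encodes_prop T q t A"
    using ex_encodes_prop_set[OF assms(1)] by blast
  ultimately show "\<exists>A. A \<subseteq> T \<times> UNIV \<and> P A" using assms(2) by blast
qed

lemma all_encodes_prop_iff:
  assumes "T \<noteq> {}" and "\<And>t A. encodes_prop T q t A \<Longrightarrow> P A \<longleftrightarrow> R t"
  shows "(\<forall>A. A \<subseteq> T \<times> UNIV \<longrightarrow> P A) \<longleftrightarrow> (\<forall>t\<in>traces_over {q}. R t)"
  using ex_encodes_prop_iff[of T q "\<lambda>A. \<not> P A" "\<lambda>t. \<not> R t"] assms by blast

lemma sat_s1se_of_hyperqptl:
  assumes "T \<noteq> {}" and "compatible T (free_tvars \<phi>) (free_pvars \<phi>) \<Pi> \<Theta> V W"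
  shows "sat_s1se T V W (s1se_of_hyperqptl \<phi>) \<longleftrightarrow> sat_hyperqptl T \<Pi> \<Theta> 0 \<phi>"
  using assms(2)
proof (induction \<phi> arbitrary: \<Pi> \<Theta> V W)
  case (ForallTrace \<pi> \<phi>)
  have "sat_s1se T (V(qvar \<pi> \<mapsto> (t, n))) W (s1se_of_hyperqptl \<phi>)
      \<longleftrightarrow> sat_hyperqptl T (\<Pi>(\<pi> \<mapsto> t)) \<Theta> 0 \<phi>" if "t \<in> T" for t n
    using ForallTrace.prems that by (intro ForallTrace.IH compatible_trace) simp_all
  then show ?case by auto
next
  case (ExistsTrace \<pi> \<phi>)
  have "sat_s1se T (V(qvar \<pi> \<mapsto> (t, n))) W (s1se_of_hyperqptl \<phi>)
      \<longleftrightarrow> sat_hyperqptl T (\<Pi>(\<pi> \<mapsto> t)) \<Theta> 0 \<phi>" if "t \<in> T" for t n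
    using ExistsTrace.prems that by (intro ExistsTrace.IH compatible_trace) simp_all
  then show ?case by auto
next
  case (ExistsProp q \<phi>)
  have "sat_s1se T V (W(SOVar (qvar q) \<mapsto> A)) (s1se_of_hyperqptl \<phi>)
      \<longleftrightarrow> sat_hyperqptl T \<Pi> (\<Theta>(q \<mapsto> t)) 0 \<phi>" if "encodes_prop T q t A" for t A
    using ExistsProp.prems that by (intro ExistsProp.IH compatible_prop) simp_all
  then show ?case
    unfolding s1se_of_hyperqptl.simps sat_s1se.simps sat_hyperqptl.simps
    by (rule ex_encodes_prop_iff[OF assms(1)])
next
  case (ForallProp q \<phi>)
  have "sat_s1se T V (W(SOVar (qvar q) \<mapsto> A)) (s1se_of_hyperqptl \<phi>)
      \<longleftrightarrow> sat_hyperqptl T \<Pi> (\<Theta>(q \<mapsto> t)) 0 \<phi>" if "encodes_prop T q t A" for t A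
    using ForallProp.prems that by (intro ForallProp.IH compatible_prop) simp_all
  then show ?case
    unfolding s1se_of_hyperqptl.simps sat_derived sat_hyperqptl.simps
    by (rule all_encodes_prop_iff[OF assms(1)])
next
  case (Body \<psi>)
  have "sat_s1se T (V(aux 0 \<mapsto> (t, 0))) W (s1se_of_qptl 0 \<psi>) \<longleftrightarrow> sat_qptl \<Pi> \<Theta> 0 \<psi>"
    if "t \<in> T" for t
    using Body that by (intro sat_s1se_of_qptl) auto
  then show ?case using assms(1) by auto
qed

theorem hyperqptl_imp_s1se:
  fixes \<phi> :: "'a hyperqptl"
  assumes "closed_hyperqptl \<phi>"
  shows "\<exists>\<psi> :: 'a s1se. closed_s1se \<psi> \<and> (\<forall>T. T \<Turnstile>\<^sub>Q \<phi> \<longleftrightarrow> T \<Turnstile>\<^sub>S \<psi>)"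
proof -
  define nonempty :: "'a s1se" where "nonempty = ExistsFO 0 (Eq (FOVar 0) (FOVar 0))"
  let ?\<psi> = "s1se_of_hyperqptl \<phi>"
  have nonempty: "T \<Turnstile>\<^sub>S nonempty \<longleftrightarrow> T \<noteq> {}" for T
    by (auto simp: nonempty_def models_s1se_def)
  have \<psi>: "T \<Turnstile>\<^sub>S ?\<psi> \<longleftrightarrow> T \<Turnstile>\<^sub>Q \<phi>" if "T \<noteq> {}" for T
    unfolding models_s1se_def models_hyperqptl_def
    using that assms
    by (intro sat_s1se_of_hyperqptl) (auto simp: closed_hyperqptl_def compatible_def)
  have "closed_s1se nonempty" "closed_s1se ?\<psi>"
    using free_s1se_of_hyperqptl[of \<phi>] assms
    by (auto simp: closed_s1se_def closed_hyperqptl_def nonempty_def)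
  then have cl: "closed_s1se (SDisj (SNeg nonempty) ?\<psi>)" "closed_s1se (SConj nonempty ?\<psi>)"
    by (auto simp: closed_s1se_def)
  show ?thesis
  proof (cases "{} \<Turnstile>\<^sub>Q \<phi>")
    case True
    have "T \<Turnstile>\<^sub>Q \<phi> \<longleftrightarrow> T \<Turnstile>\<^sub>S SDisj (SNeg nonempty) ?\<psi>" for T
      using True \<psi>[of T] nonempty[of T] by (cases "T = {}") (auto simp: models_s1se_def)
    with cl(1) show ?thesis by blast
  next
    case False
    have "T \<Turnstile>\<^sub>Q \<phi> \<longleftrightarrow> T \<Turnstile>\<^sub>S SConj nonempty ?\<psi>" for T
      using False \<psi>[of T] nonempty[of T] by (cases "T = {}") (auto simp: models_s1se_def)
    with cl(2) show ?thesis by blast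
  qed
qed


section \<open>Perfect squares in S1S[E]\<close>

definition ForallIn :: "fovar \<Rightarrow> 'a sovar \<Rightarrow> 'a s1se \<Rightarrow> 'a s1se" where
  "ForallIn x X \<phi> = ForallFO x (SImp (Mem (FOVar x) X) \<phi>)"

definition ExistsIn :: "fovar \<Rightarrow> 'a sovar \<Rightarrow> 'a s1se \<Rightarrow> 'a s1se" where
  "ExistsIn x X \<phi> = ExistsFO x (SConj (Mem (FOVar x) X) \<phi>)"

lemma sat_bounded:
  assumes "the (W X) \<subseteq> T \<times> UNIV"
  shows "sat_s1se T V W (ForallIn x X \<phi>) \<longleftrightarrow> (\<forall>p \<in> the (W X). sat_s1se T (V(x \<mapsto> p)) W \<phi>)"
    and "sat_s1se T V W (ExistsIn x X \<phi>) \<longleftrightarrow> (\<exists>p \<in> the (W X). sat_s1se T (V(x \<mapsto> p)) W \<phi>)"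
  using assms by (auto simp: ForallIn_def ExistsIn_def)

lemma free_bounded [simp]:
  "free_fovars (ForallIn x X \<phi>) = insert x (free_fovars \<phi>) - {x}"
  "free_fovars (ExistsIn x X \<phi>) = insert x (free_fovars \<phi>) - {x}"
  "free_sovars (ForallIn x X \<phi>) = insert X (free_sovars \<phi>)"
  "free_sovars (ExistsIn x X \<phi>) = insert X (free_sovars \<phi>)"
  by (auto simp: ForallIn_def ExistsIn_def)

text \<open>A function from \<open>T\<close> to the naturals is given by its graph, which is a
  subset of the domain of S1S[E]. Equality of \<open>MinOf\<close> terms compares traces
  only.\<close>

definition is_function :: "'a sovar \<Rightarrow> 'a s1se" where
  "is_function X = SConj
     (ForallFO 0 (ExistsIn 1 X (Eq (MinOf 1) (MinOf 0))))
     (ForallIn 0 X (ForallIn 1 X (SImp (Eq (MinOf 0) (MinOf 1)) (Eq (FOVar 0) (FOVar 1)))))"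

lemma sat_is_function:
  assumes "the (W X) \<subseteq> T \<times> UNIV"
  shows "sat_s1se T V W (is_function X) \<longleftrightarrow> (\<exists>f. the (W X) = (\<lambda>t. (t, f t)) ` T)"
proof -
  have "sat_s1se T V W (is_function X) \<longleftrightarrow>
      (\<forall>t\<in>T. \<exists>n. (t, n) \<in> the (W X)) \<and> (\<forall>p\<in>the (W X). \<forall>q\<in>the (W X). fst p = fst q \<longrightarrow> p = q)"
    unfolding is_function_def by (fastforce simp: sat_bounded[of W X T, OF assms])
  also have "\<dots> \<longleftrightarrow> (\<exists>f. the (W X) = (\<lambda>t. (t, f t)) ` T)"
  proof (intro iffI; (elim conjE exE)?)
    assume "\<forall>t\<in>T. \<exists>n. (t, n) \<in> the (W X)"
    then obtain f where f: "\<forall>t\<in>T. (t, f t) \<in> the (W X)" by metis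
    assume unique: "\<forall>p\<in>the (W X). \<forall>q\<in>the (W X). fst p = fst q \<longrightarrow> p = q"
    have "p \<in> (\<lambda>t. (t, f t)) ` T" if "p \<in> the (W X)" for p
    proof -
      from that assms have "fst p \<in> T" by auto
      moreover from this f unique that have "p = (fst p, f (fst p))" by force
      ultimately show ?thesis by blast
    qed
    with f have "the (W X) = (\<lambda>t. (t, f t)) ` T" by blast
    then show "\<exists>f. the (W X) = (\<lambda>t. (t, f t)) ` T" by (intro exI[of _ f])
  qed auto
  finally show ?thesis .
qed

text \<open>\<open>EqLevel\<close> compares function values across different traces. The formula
  makes the pairing of the two functions surjective onto the product of their ranges.\<close>

definition all_pairs :: "'a sovar \<Rightarrow> 'a sovar \<Rightarrow> 'a s1se" where
  "all_pairs X Y = ForallIn 0 X (ForallIn 1 Y (ExistsIn 2 X (ExistsIn 3 Y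
     (SConj (Eq (MinOf 2) (MinOf 3))
       (SConj (EqLevel (FOVar 2) (FOVar 0)) (EqLevel (FOVar 3) (FOVar 1)))))))"

text \<open>Variables 0 and 1 hold the two values at one trace, 2 and 3 those at another. This is
  injectivity of the pairing.\<close>

definition distinct_pairs :: "'a sovar \<Rightarrow> 'a sovar \<Rightarrow> 'a s1se" where
  "distinct_pairs X Y = ForallIn 0 X (ForallIn 1 Y (ForallIn 2 X (ForallIn 3 Y (SImp
     (SConj (SConj (Eq (MinOf 0) (MinOf 1)) (Eq (MinOf 2) (MinOf 3)))
       (SConj (EqLevel (FOVar 0) (FOVar 2)) (EqLevel (FOVar 1) (FOVar 3))))
     (Eq (FOVar 0) (FOVar 2))))))"

definition levels_subset :: "'a sovar \<Rightarrow> 'a sovar \<Rightarrow> 'a s1se" where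
  "levels_subset X Y = ForallIn 0 X (ExistsIn 1 Y (EqLevel (FOVar 0) (FOVar 1)))"

context
  fixes T :: "'a trace set" and f g :: "'a trace \<Rightarrow> nat" and W and X Y :: "'a sovar"
  assumes X: "the (W X) = (\<lambda>t. (t, f t)) ` T" and Y: "the (W Y) = (\<lambda>t. (t, g t)) ` T"
begin

private lemma subset: "the (W X) \<subseteq> T \<times> UNIV" "the (W Y) \<subseteq> T \<times> UNIV"
  by (auto simp: X Y)

private lemmas sat = sat_bounded[of W X T, OF subset(1), unfolded X]
  sat_bounded[of W Y T, OF subset(2), unfolded Y]

lemma sat_all_pairs:
  "sat_s1se T V W (all_pairs X Y) \<longleftrightarrow> (\<forall>s\<in>T. \<forall>t\<in>T. \<exists>r\<in>T. f r = f s \<and> g r = g t)"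
  by (simp add: all_pairs_def sat)

lemma sat_distinct_pairs:
  "sat_s1se T V W (distinct_pairs X Y) \<longleftrightarrow> inj_on (\<lambda>t. (f t, g t)) T"
  by (auto simp: distinct_pairs_def sat inj_on_def)

lemma sat_levels_subset:
  "sat_s1se T V W (levels_subset X Y) \<longleftrightarrow> f ` T \<subseteq> g ` T"
  by (auto simp: levels_subset_def sat)

end

definition square_card :: "'a s1se" where
  "square_card = (let X = SOVar 0; Y = SOVar 1 in
     ExistsSO X (ExistsSO Y (SConj (SConj (is_function X) (is_function Y))
       (SConj (SConj (all_pairs X Y) (distinct_pairs X Y))
         (SConj (levels_subset X Y) (levels_subset Y X))))))"

lemma closed_square_card: "closed_s1se square_card"
  by (auto simp: closed_s1se_def square_card_def Let_def is_function_def all_pairs_def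
      distinct_pairs_def levels_subset_def)

text \<open>The right-hand side makes \<open>t \<mapsto> (f t, g t)\<close> a bijection from
  \<open>T\<close> onto \<open>R \<times> R\<close>, where \<open>R\<close> is the common range of
  \<open>f\<close> and \<open>g\<close>.\<close>

lemma models_square_card_iff:
  "T \<Turnstile>\<^sub>S square_card \<longleftrightarrow>
     (\<exists>f g. (\<forall>s\<in>T. \<forall>t\<in>T. \<exists>r\<in>T. f r = f s \<and> g r = (g t :: nat)) \<and>
       inj_on (\<lambda>t. (f t, g t)) T \<and> f ` T = g ` T)" (is "?lhs \<longleftrightarrow> ?rhs")
proof
  assume ?lhs
  then obtain A B where AB: "A \<subseteq> T \<times> UNIV" "B \<subseteq> T \<times> UNIV" and
    sat: "let W = (ap_valuation T)(SOVar 0 \<mapsto> A, SOVar 1 \<mapsto> B); X = SOVar 0; Y = SOVar 1 in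
      sat_s1se T Map.empty W (is_function X) \<and> sat_s1se T Map.empty W (is_function Y) \<and>
      sat_s1se T Map.empty W (all_pairs X Y) \<and> sat_s1se T Map.empty W (distinct_pairs X Y) \<and>
      sat_s1se T Map.empty W (levels_subset X Y) \<and> sat_s1se T Map.empty W (levels_subset Y X)"
    unfolding models_s1se_def square_card_def Let_def by auto
  define W where "W = (ap_valuation T)(SOVar 0 \<mapsto> A, SOVar 1 \<mapsto> B)"
  have W: "the (W (SOVar 0)) = A" "the (W (SOVar 1)) = B" by (auto simp: W_def)
  note sat = sat[unfolded Let_def, folded W_def]
  have sub: "the (W (SOVar 0)) \<subseteq> T \<times> UNIV" "the (W (SOVar 1)) \<subseteq> T \<times> UNIV"
    unfolding W by (fact AB)+
  from sat have "sat_s1se T Map.empty W (is_function (SOVar 0))" by (rule conjunct1)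
  then obtain f where f: "the (W (SOVar 0)) = (\<lambda>t. (t, f t)) ` T"
    unfolding sat_is_function[of W "SOVar 0" T, OF sub(1)] by (rule exE)
  from sat have "sat_s1se T Map.empty W (is_function (SOVar 1))" by (rule conjE) (rule conjunct1)
  then obtain g where g: "the (W (SOVar 1)) = (\<lambda>t. (t, g t)) ` T"
    unfolding sat_is_function[of W "SOVar 1" T, OF sub(2)] by (rule exE)
  show ?rhs
    using sat unfolding sat_all_pairs[OF f g] sat_distinct_pairs[OF f g]
      sat_levels_subset[OF f g] sat_levels_subset[OF g f]
    by (elim conjE) (intro exI[of _ f] exI[of _ g] conjI subset_antisym)
next
  assume ?rhs
  then obtain f g where fg: "\<forall>s\<in>T. \<forall>t\<in>T. \<exists>r\<in>T. f r = f s \<and> g r = (g t :: nat)"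
    "inj_on (\<lambda>t. (f t, g t)) T" "f ` T = g ` T" by blast
  define W where "W = (ap_valuation T)
    (SOVar 0 \<mapsto> (\<lambda>t. (t, f t)) ` T, SOVar 1 \<mapsto> (\<lambda>t. (t, g t)) ` T)"
  have W: "the (W (SOVar 0)) = (\<lambda>t. (t, f t)) ` T" "the (W (SOVar 1)) = (\<lambda>t. (t, g t)) ` T"
    by (auto simp: W_def)
  have "sat_s1se T Map.empty W (is_function (SOVar 0))"
    "sat_s1se T Map.empty W (is_function (SOVar 1))"
    using W by (subst sat_is_function; auto)+
  moreover have "sat_s1se T Map.empty W (all_pairs (SOVar 0) (SOVar 1))"
    "sat_s1se T Map.empty W (distinct_pairs (SOVar 0) (SOVar 1))"
    "sat_s1se T Map.empty W (levels_subset (SOVar 0) (SOVar 1))"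
    "sat_s1se T Map.empty W (levels_subset (SOVar 1) (SOVar 0))"
    unfolding sat_all_pairs[OF W] sat_distinct_pairs[OF W] sat_levels_subset[OF W]
      sat_levels_subset[OF W(2,1)]
    using fg(1,2) equalityD1[OF fg(3)] equalityD2[OF fg(3)] by this
  ultimately show ?lhs
    unfolding models_s1se_def square_card_def Let_def W_def sat_s1se.simps(7)
    by (intro exI[of _ "(\<lambda>t. (t, f t)) ` T"] exI[of _ "(\<lambda>t. (t, g t)) ` T"] conjI) auto
qed

text \<open>Finiteness matters: an uncountable \<open>T\<close> has \<open>card T = 0\<close>, a
  square, but admits no injection into pairs of naturals.\<close>

lemma models_square_card:
  assumes "finite T"
  shows "T \<Turnstile>\<^sub>S square_card \<longleftrightarrow> (\<exists>k. card T = k\<^sup>2)"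
proof
  assume "T \<Turnstile>\<^sub>S square_card"
  then obtain f g where fg: "\<forall>s\<in>T. \<forall>t\<in>T. \<exists>r\<in>T. f r = f s \<and> g r = (g t :: nat)"
    "inj_on (\<lambda>t. (f t, g t)) T" "f ` T = g ` T"
    unfolding models_square_card_iff by blast
  have "(f s, g t) \<in> (\<lambda>t. (f t, g t)) ` T" if st: "s \<in> T" "t \<in> T" for s t
  proof -
    from fg(1) st obtain r where "r \<in> T" "f r = f s" "g r = g t" by blast
    then show ?thesis by (intro image_eqI[of _ _ r]) simp_all
  qed
  then have "(\<lambda>t. (f t, g t)) ` T = f ` T \<times> g ` T" by auto
  with fg(2,3) have "card T = card (f ` T \<times> f ` T)" by (metis card_image)
  then have "card T = (card (f ` T))\<^sup>2" by (simp only: card_cartesian_product power2_eq_square)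
  then show "\<exists>k. card T = k\<^sup>2" ..
next
  assume "\<exists>k. card T = k\<^sup>2"
  then obtain k where "card T = k\<^sup>2" ..
  then have "card T = card ({..<k} \<times> {..<k})" by (simp add: power2_eq_square)
  with assms obtain h where h: "bij_betw h T ({..<k} \<times> {..<k})"
    by (metis finite_same_card_bij finite_SigmaI finite_lessThan)
  have surj: "h ` T = {..<k} \<times> {..<k}" by (rule bij_betw_imp_surj_on[OF h])
  \<comment> \<open>The coordinates of a bijection onto a \<open>k\<close> by \<open>k\<close> grid;
    both have range \<open>{..<k}\<close>.\<close>
  define f g where "f = fst \<circ> h" and "g = snd \<circ> h"
  have "f ` T = g ` T" unfolding f_def g_def image_comp[symmetric] surj by simp
  moreover have "\<exists>r\<in>T. f r = f s \<and> g r = g t" if "s \<in> T" "t \<in> T" for s t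
  proof -
    have "(f s, g t) \<in> h ` T" using bij_betwE[OF h] that by (force simp: surj f_def g_def)
    then obtain r where "r \<in> T" "h r = (f s, g t)" by (metis imageE)
    then show ?thesis by (intro bexI[of _ r]) (simp_all add: f_def g_def)
  qed
  moreover have "inj_on (\<lambda>t. (f t, g t)) T"
    using bij_betw_imp_inj_on[OF h] by (simp add: f_def g_def)
  ultimately show "T \<Turnstile>\<^sub>S square_card" unfolding models_square_card_iff by blast
qed


section \<open>Finite colourings of words that are stable under prepending a letter\<close>

text \<open>A substitute for an automaton: as words are infinite to the right, colours are
  propagated from a tail back to the front.\<close>

definition colouring :: "((nat \<Rightarrow> 'l) \<Rightarrow> 'c) \<Rightarrow> (nat \<Rightarrow> 'l) set \<Rightarrow> bool" where
  "colouring c L \<longleftrightarrow> finite (range c) \<and>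
     (\<forall>a y y'. c y = c y' \<longrightarrow> c (case_nat a y) = c (case_nat a y')) \<and>
     (\<forall>y y'. c y = c y' \<longrightarrow> (y \<in> L \<longleftrightarrow> y' \<in> L))"

text \<open>Types cannot be quantified existentially, so the colours are naturals here;
  \<open>colourableI\<close> accepts every colour type, since a finite range injects into the
  naturals.\<close>

definition colourable :: "(nat \<Rightarrow> 'l) set \<Rightarrow> bool" where
  "colourable L \<longleftrightarrow> (\<exists>c :: (nat \<Rightarrow> 'l) \<Rightarrow> nat. colouring c L)"

lemma colouringD:
  assumes "colouring c L"
  shows "finite (range c)"
    and "c y = c y' \<Longrightarrow> c (case_nat a y) = c (case_nat a y')"
    and "c y = c y' \<Longrightarrow> y \<in> L \<longleftrightarrow> y' \<in> L"
  using assms unfolding colouring_def by blast+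

lemma colourableI:
  assumes "colouring c L"
  shows "colourable L"
proof -
  from colouringD(1)[OF assms] obtain h :: "_ \<Rightarrow> nat" where "inj_on h (range c)"
    using finite_imp_inj_to_nat_seg by blast
  then have eq: "h (c y) = h (c y') \<longleftrightarrow> c y = c y'" for y y' by (auto simp: inj_on_def)
  have "finite (range (\<lambda>y. h (c y)))"
    using finite_imageI[OF colouringD(1)[OF assms], of h] by (simp add: image_image)
  then have "colouring (\<lambda>y. h (c y)) L"
    using assms unfolding colouring_def eq by blast
  then show ?thesis unfolding colourable_def by blast
qed

lemma finite_range_Pair: "finite (range f) \<Longrightarrow> finite (range g) \<Longrightarrow> finite (range (\<lambda>x. (f x, g x)))"
  by (rule finite_subset[of _ "range f \<times> range g"]) auto

lemma colourable_Compl: "colourable L \<Longrightarrow> colourable (- L)"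
  unfolding colourable_def colouring_def Compl_iff by blast

lemma colourable_Int:
  assumes "colourable L" and "colourable M"
  shows "colourable (L \<inter> M)"
proof -
  obtain c d :: "_ \<Rightarrow> nat" where c: "colouring c L" and d: "colouring d M"
    using assms unfolding colourable_def by blast
  have "colouring (\<lambda>y. (c y, d y)) (L \<inter> M)"
    unfolding colouring_def prod.inject Int_iff
    using finite_range_Pair[OF colouringD(1)[OF c] colouringD(1)[OF d]]
      colouringD(2,3)[OF c] colouringD(2,3)[OF d] by blast
  then show ?thesis by (rule colourableI)
qed

lemma colourable_Un:
  assumes "colourable L" and "colourable M"
  shows "colourable (L \<union> M)"
  using colourable_Compl[OF colourable_Int[OF assms[THEN colourable_Compl]]] by simp

text \<open>The truth value itself is a colour: after a letter is prepended it depends on that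
  letter alone.\<close>

lemma colourable_first: "colourable {w. P (w 0)}"
  by (rule colourableI[of "\<lambda>w. P (w 0)"]) (auto simp: colouring_def)

text \<open>The colour also records whether the tail is in \<open>L\<close>. After prepending, the
  tail is the old word, whose membership is read off its old colour.\<close>

lemma colourable_next:
  assumes "colourable L"
  shows "colourable {w. w \<circ> Suc \<in> L}"
proof -
  obtain c :: "_ \<Rightarrow> nat" where c: "colouring c L" using assms unfolding colourable_def by blast
  have suc: "case_nat a y \<circ> Suc = y" for a :: 'a and y by auto
  have "finite (range (\<lambda>y. (c y, y \<circ> Suc \<in> L)))"
    by (rule finite_range_Pair[OF colouringD(1)[OF c]]) simp
  then have "colouring (\<lambda>y. (c y, y \<circ> Suc \<in> L)) {w. w \<circ> Suc \<in> L}"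
    unfolding colouring_def prod.inject suc mem_Collect_eq using colouringD(2,3)[OF c] by blast
  then show ?thesis by (rule colourableI)
qed

text \<open>The product colour is extended by membership in \<open>U\<close>. By the recurrence,
  this bit of a prepended word is fixed by its membership in \<open>M\<close> and \<open>L\<close>
  and by the old bit.\<close>

lemma colourable_until:
  assumes "colourable L" and "colourable M"
    and unfold: "\<And>w. w \<in> U \<longleftrightarrow> w \<in> M \<or> w \<in> L \<and> w \<circ> Suc \<in> U"
  shows "colourable U"
proof -
  obtain c d :: "_ \<Rightarrow> nat" where c: "colouring c L" and d: "colouring d M"
    using assms unfolding colourable_def by blast
  have suc: "case_nat a y \<circ> Suc = y" for a :: 'a and y by auto
  have U: "case_nat a y \<in> U \<longleftrightarrow> case_nat a y \<in> M \<or> case_nat a y \<in> L \<and> y \<in> U" for a y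
    using unfold[of "case_nat a y"] by (simp only: suc)
  have "colouring (\<lambda>y. ((c y, d y), y \<in> U)) U"
    unfolding colouring_def
  proof (intro conjI allI impI)
    show "finite (range (\<lambda>y. ((c y, d y), y \<in> U)))"
      using colouringD(1)[OF c] colouringD(1)[OF d] by (intro finite_range_Pair) auto
  next
    fix a y y' assume "((c y, d y), y \<in> U) = ((c y', d y'), y' \<in> U)"
    then have "c (case_nat a y) = c (case_nat a y')" "d (case_nat a y) = d (case_nat a y')"
      "y \<in> U \<longleftrightarrow> y' \<in> U"
      using colouringD(2)[OF c] colouringD(2)[OF d] by (blast dest: prod.inject[THEN iffD1])+
    then show "((c (case_nat a y), d (case_nat a y)), case_nat a y \<in> U) =
        ((c (case_nat a y'), d (case_nat a y')), case_nat a y' \<in> U)"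
      using colouringD(3)[OF c] colouringD(3)[OF d] unfolding U by blast
  qed simp
  then show ?thesis by (rule colourableI)
qed

text \<open>Overwrites one component of every letter, whatever it was before, so that quantifying
  over \<open>s\<close> amounts to projecting this component away.\<close>

definition set_track :: "'v \<Rightarrow> nat set \<Rightarrow> (nat \<Rightarrow> 'v set) \<Rightarrow> nat \<Rightarrow> 'v set" where
  "set_track v s w = (\<lambda>i. if i \<in> s then insert v (w i) else w i - {v})"

lemma set_track_case_nat:
  "set_track v s (case_nat a y) =
     case_nat (if 0 \<in> s then insert v a else a - {v}) (set_track v {i. Suc i \<in> s} y)"
  by (auto simp: set_track_def fun_eq_iff split: nat.splits)

text \<open>The new colour is the set of colours of all variants of the word, as in a subset construction.\<close>

lemma colourable_projection:
  assumes "colourable L"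
  shows "colourable {w. \<exists>s. set_track v s w \<in> L}"
proof -
  obtain c :: "_ \<Rightarrow> nat" where c: "colouring c L" using assms unfolding colourable_def by blast
  define d where "d w = range (\<lambda>s. c (set_track v s w))" for w
  have step: "d (case_nat a y) \<subseteq> d (case_nat a y')" if eq: "d y = d y'" for a y y'
  proof
    fix x assume "x \<in> d (case_nat a y)"
    then obtain s where s: "x = c (set_track v s (case_nat a y))" by (auto simp: d_def)
    have "c (set_track v {i. Suc i \<in> s} y) \<in> d y'" unfolding eq[symmetric] by (auto simp: d_def)
    then obtain r where r: "c (set_track v {i. Suc i \<in> s} y) = c (set_track v r y')"
      by (auto simp: d_def)
    \<comment> \<open>Glue the first position of \<open>s\<close> to the variant \<open>r\<close> of
      the other tail, which has the matching colour.\<close>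
    define s' where "s' = (if 0 \<in> s then {0} else {}) \<union> Suc ` r"
    have s': "{i. Suc i \<in> s'} = r" "0 \<in> s' \<longleftrightarrow> 0 \<in> s" by (auto simp: s'_def)
    have "x = c (set_track v s' (case_nat a y'))"
      unfolding s set_track_case_nat s' using colouringD(2)[OF c] r by blast
    then show "x \<in> d (case_nat a y')" by (auto simp: d_def)
  qed
  have "range d \<subseteq> Pow (range c)" by (auto simp: d_def)
  then have "finite (range d)" using colouringD(1)[OF c] by (meson finite_Pow_iff finite_subset)
  \<comment> \<open>Colour classes of \<open>c\<close> lie inside \<open>L\<close> or outside it, so
    membership of a variant is visible in its colour.\<close>
  moreover have "(\<exists>s. set_track v s y \<in> L) \<longleftrightarrow> d y \<inter> c ` L \<noteq> {}" for y
    using colouringD(3)[OF c] unfolding d_def by blast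
  then have "(\<exists>s. set_track v s y \<in> L) \<longleftrightarrow> (\<exists>s. set_track v s y' \<in> L)" if "d y = d y'" for y y'
    by (simp only: that)
  moreover have "d (case_nat a y) = d (case_nat a y')" if "d y = d y'" for a y y'
    using step[OF that] step[OF that[symmetric]] by (rule subset_antisym)
  ultimately have "colouring d {w. \<exists>s. set_track v s w \<in> L}"
    unfolding colouring_def mem_Collect_eq by (intro conjI allI impI) assumption+
  then show ?thesis by (rule colourableI)
qed


section \<open>HyperQPTL on sets of singleton traces\<close>

text \<open>A letter is the set of tracks that hold at a position. One word thus codes the trace set
  (\<open>Marker\<close>) together with both assignments.\<close>

datatype track = Marker | TTrack tvar | PTrack pvar

definition singleton_trace :: "nat \<Rightarrow> 'a trace" where
  "singleton_trace k = (\<lambda>i. if i = k then UNIV else {})"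

definition marked :: "(nat \<Rightarrow> track set) \<Rightarrow> 'a trace set" where
  "marked w = singleton_trace ` {k. Marker \<in> w k}"

text \<open>With \<open>UNIV\<close> all atomic propositions behave alike, so one track per trace
  variable suffices. The track may be an arbitrary set of positions; that it codes a trace of the
  set is imposed by \<open>marked_singleton\<close>.\<close>

definition tassign :: "(nat \<Rightarrow> track set) \<Rightarrow> tvar \<rightharpoonup> 'a trace" where
  "tassign w = (\<lambda>\<pi>. Some (\<lambda>i. if TTrack \<pi> \<in> w i then UNIV else {}))"

definition passign :: "(nat \<Rightarrow> track set) \<Rightarrow> pvar \<rightharpoonup> pvar trace" where
  "passign w = (\<lambda>q. Some (\<lambda>i. if PTrack q \<in> w i then {q} else {}))"

abbreviation word_sat_qptl :: "(nat \<Rightarrow> track set) \<Rightarrow> nat \<Rightarrow> 'a qptl \<Rightarrow> bool" where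
  "word_sat_qptl w \<equiv> sat_qptl (tassign w) (passign w)"

abbreviation word_sat :: "(nat \<Rightarrow> track set) \<Rightarrow> 'a hyperqptl \<Rightarrow> bool" where
  "word_sat w \<equiv> sat_hyperqptl (marked w) (tassign w) (passign w) 0"

text \<open>Trading positions for suffixes turns the temporal operators into operations on languages
  of words.\<close>

lemma word_sat_qptl_Suc: "word_sat_qptl w (Suc i) \<psi> \<longleftrightarrow> word_sat_qptl (w \<circ> Suc) i \<psi>"
proof (induction \<psi> arbitrary: i)
  case (Until \<psi>1 \<psi>2)
  have Suc_le: "(\<exists>j\<ge>Suc i. R j) \<longleftrightarrow> (\<exists>j\<ge>i. R (Suc j))" "(\<forall>j\<ge>Suc i. R j) \<longleftrightarrow> (\<forall>j\<ge>i. R (Suc j))" for R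
    using Suc_le_D by blast+
  have "(\<exists>j\<ge>Suc i. P j \<and> (\<forall>k. Suc i \<le> k \<and> k < j \<longrightarrow> Q k)) \<longleftrightarrow>
      (\<exists>j\<ge>i. P (Suc j) \<and> (\<forall>k. i \<le> k \<and> k < j \<longrightarrow> Q (Suc k)))" for P Q
    unfolding Suc_le(1) imp_conjL Suc_le(2) by simp
  then show ?case by (simp add: Until.IH)
qed (auto simp: tassign_def passign_def)

lemma colourable_qptl: "colourable {w. word_sat_qptl w 0 \<psi>}"
proof (induction \<psi>)
  case (Atom a \<pi>)
  then show ?case using colourable_first[of "\<lambda>x. TTrack \<pi> \<in> x"]
    by (simp add: tassign_def if_distrib cong: if_cong)
next
  case (PVar q)
  then show ?case using colourable_first[of "\<lambda>x. PTrack q \<in> x"]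
    by (simp add: passign_def if_distrib cong: if_cong)
next
  case (Neg \<psi>)
  then show ?case using colourable_Compl by (fastforce simp: Compl_eq)
next
  case (Disj \<psi>1 \<psi>2)
  then show ?case using colourable_Un by (fastforce simp: Un_def)
next
  case (Next \<psi>)
  then show ?case using colourable_next by (fastforce simp: word_sat_qptl_Suc)
next
  case (Until \<psi>1 \<psi>2)
  show ?case
  proof (rule colourable_until[OF Until])
    fix w
    show "w \<in> {w. word_sat_qptl w 0 (Until \<psi>1 \<psi>2)} \<longleftrightarrow>
      w \<in> {w. word_sat_qptl w 0 \<psi>2} \<or>
      w \<in> {w. word_sat_qptl w 0 \<psi>1} \<and> w \<circ> Suc \<in> {w. word_sat_qptl w 0 (Until \<psi>1 \<psi>2)}"
      unfolding mem_Collect_eq word_sat_qptl_Suc[symmetric] by (rule sat_qptl_until_unfold)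
  qed
qed

definition marked_singleton :: "tvar \<Rightarrow> (nat \<Rightarrow> track set) set" where
  "marked_singleton \<pi> = {w. \<exists>k. Marker \<in> w k \<and> (\<forall>i. TTrack \<pi> \<in> w i \<longleftrightarrow> i = k)}"

text \<open>Besides membership, the colour records that the track does not occur at all: this is
  required of the tail when the prepended letter carries the only occurrence.\<close>

lemma colourable_marked_singleton: "colourable (marked_singleton \<pi>)"
proof -
  let ?none = "\<lambda>y :: nat \<Rightarrow> track set. \<forall>i. TTrack \<pi> \<notin> y i"
  have none: "?none (case_nat a y) \<longleftrightarrow> TTrack \<pi> \<notin> a \<and> ?none y" for a y
    by (auto split: nat.splits)
  have ex: "(\<exists>k. P k) \<longleftrightarrow> P 0 \<or> (\<exists>k. P (Suc k))"
    and all: "(\<forall>k. P k) \<longleftrightarrow> P 0 \<and> (\<forall>k. P (Suc k))" for P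
    by (metis nat.exhaust)+
  have single: "case_nat a y \<in> marked_singleton \<pi> \<longleftrightarrow>
      (if TTrack \<pi> \<in> a then Marker \<in> a \<and> ?none y else y \<in> marked_singleton \<pi>)" (is "?l = ?r") for a y
  proof -
    have "?l \<longleftrightarrow> (Marker \<in> a \<and> (\<forall>i. TTrack \<pi> \<in> case_nat a y i \<longleftrightarrow> i = 0)) \<or>
        (\<exists>k. Marker \<in> y k \<and> (\<forall>i. TTrack \<pi> \<in> case_nat a y i \<longleftrightarrow> i = Suc k))"
      unfolding marked_singleton_def mem_Collect_eq by (subst ex) simp
    also have "\<dots> \<longleftrightarrow> ?r"
      unfolding marked_singleton_def mem_Collect_eq
        all[of "\<lambda>i. TTrack \<pi> \<in> case_nat a y i \<longleftrightarrow> i = 0"]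
        all[of "\<lambda>i. TTrack \<pi> \<in> case_nat a y i \<longleftrightarrow> i = Suc _"]
      by auto
    finally show ?thesis .
  qed
  have "colouring (\<lambda>y. (y \<in> marked_singleton \<pi>, ?none y)) (marked_singleton \<pi>)"
    unfolding colouring_def single none by auto
  then show ?thesis by (rule colourableI)
qed

lemma word_set_track [simp]:
  "marked (set_track (TTrack \<pi>) s w) = marked w"
  "marked (set_track (PTrack q) s w) = marked w"
  "tassign (set_track (PTrack q) s w) = tassign w"
  "passign (set_track (TTrack \<pi>) s w) = passign w"
  "tassign (set_track (TTrack \<pi>) s w) = (tassign w)(\<pi> \<mapsto> \<lambda>i. if i \<in> s then UNIV else {})"
  "passign (set_track (PTrack q) s w) = (passign w)(q \<mapsto> \<lambda>i. if i \<in> s then {q} else {})"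
  by (auto simp: set_track_def marked_def tassign_def passign_def fun_eq_iff)

lemma set_track_in_marked_singleton:
  "set_track (TTrack \<pi>) s w \<in> marked_singleton \<pi> \<longleftrightarrow> (\<exists>k. Marker \<in> w k \<and> s = {k})"
  by (auto simp: marked_singleton_def set_track_def)

lemma traces_over_singleton: "traces_over {q} = range (\<lambda>s i. if i \<in> s then {q} else {})"
proof (intro set_eqI iffI)
  fix t assume "t \<in> traces_over {q}"
  then have "t = (\<lambda>i. if i \<in> {i. q \<in> t i} then {q} else {})"
    by (auto simp: traces_over_def fun_eq_iff)
  then show "t \<in> range (\<lambda>s i. if i \<in> s then {q} else {})" by blast
qed (auto simp: traces_over_def split: if_splits)

text \<open>The test is phrased as \<open>i \<in> {k}\<close> to match the assignment updates in
  \<open>word_set_track\<close>.\<close>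

lemma bounded_marked:
  "(\<exists>t\<in>marked w. P t) \<longleftrightarrow> (\<exists>k. Marker \<in> w k \<and> P (\<lambda>i. if i \<in> {k} then UNIV else {}))"
  "(\<forall>t\<in>marked w. P t) \<longleftrightarrow> (\<forall>k. Marker \<in> w k \<longrightarrow> P (\<lambda>i. if i \<in> {k} then UNIV else {}))"
  by (auto simp: marked_def singleton_trace_def)

text \<open>Quantifiers become projections, with universal ones expressed by complements. Trace
  quantifiers are relativised to \<open>marked_singleton\<close>; rewriting a variable track leaves
  the trace set unchanged.\<close>

lemma word_sat_quantifiers:
  "word_sat w (ExistsTrace \<pi> \<phi>) \<longleftrightarrow>
     (\<exists>s. set_track (TTrack \<pi>) s w \<in> marked_singleton \<pi> \<inter> {w. word_sat w \<phi>})"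
  "word_sat w (ForallTrace \<pi> \<phi>) \<longleftrightarrow>
     \<not> (\<exists>s. set_track (TTrack \<pi>) s w \<in> marked_singleton \<pi> \<inter> - {w. word_sat w \<phi>})"
  "word_sat w (ExistsProp q \<phi>) \<longleftrightarrow> (\<exists>s. set_track (PTrack q) s w \<in> {w. word_sat w \<phi>})"
  "word_sat w (ForallProp q \<phi>) \<longleftrightarrow> \<not> (\<exists>s. set_track (PTrack q) s w \<in> - {w. word_sat w \<phi>})"
  unfolding sat_hyperqptl.simps bounded_marked traces_over_singleton Int_iff Compl_iff mem_Collect_eq
    set_track_in_marked_singleton word_set_track
  by blast+

lemma colourable_hyperqptl: "colourable {w. word_sat w \<phi>}"
proof (induction \<phi>)
  case (ForallTrace \<pi> \<phi>)
  from colourable_Compl[OF colourable_projection[OF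
        colourable_Int[OF colourable_marked_singleton colourable_Compl[OF this]]]]
  show ?case unfolding word_sat_quantifiers Compl_eq mem_Collect_eq .
next
  case (ExistsTrace \<pi> \<phi>)
  from colourable_projection[OF colourable_Int[OF colourable_marked_singleton this]]
  show ?case unfolding word_sat_quantifiers .
next
  case (ExistsProp q \<phi>)
  from colourable_projection[OF this]
  show ?case unfolding word_sat_quantifiers .
next
  case (ForallProp q \<phi>)
  from colourable_Compl[OF colourable_projection[OF colourable_Compl[OF this]]]
  show ?case unfolding word_sat_quantifiers Compl_eq mem_Collect_eq .
next
  case (Body \<psi>)
  show ?case using colourable_qptl[of \<psi>] by simp
qed

section \<open>Ultimate periodicity and the separation\<close>

lemma sat_qptl_cong:
  assumes "\<And>\<pi>. \<pi> \<in> tvars_qptl \<psi> \<Longrightarrow> \<Pi> \<pi> = \<Pi>' \<pi>" and "\<And>q. q \<in> pvars_qptl \<psi> \<Longrightarrow> \<Theta> q = \<Theta>' q"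
  shows "sat_qptl \<Pi> \<Theta> i \<psi> \<longleftrightarrow> sat_qptl \<Pi>' \<Theta>' i \<psi>"
  using assms by (induction \<psi> arbitrary: i) auto

text \<open>For closed formulas this replaces the assignments read off a word by the empty ones used
  in \<open>models_hyperqptl\<close>.\<close>

lemma sat_hyperqptl_cong:
  assumes "\<And>\<pi>. \<pi> \<in> free_tvars \<phi> \<Longrightarrow> \<Pi> \<pi> = \<Pi>' \<pi>" and "\<And>q. q \<in> free_pvars \<phi> \<Longrightarrow> \<Theta> q = \<Theta>' q"
  shows "sat_hyperqptl T \<Pi> \<Theta> i \<phi> \<longleftrightarrow> sat_hyperqptl T \<Pi>' \<Theta>' i \<phi>"
  using assms
proof (induction \<phi> arbitrary: \<Pi> \<Pi>' \<Theta> \<Theta>')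
  case (ForallTrace \<pi> \<phi>)
  have "sat_hyperqptl T (\<Pi>(\<pi> \<mapsto> t)) \<Theta> i \<phi> \<longleftrightarrow> sat_hyperqptl T (\<Pi>'(\<pi> \<mapsto> t)) \<Theta>' i \<phi>" for t
    by (rule ForallTrace.IH) (use ForallTrace.prems in simp_all)
  then show ?case by simp
next
  case (ExistsTrace \<pi> \<phi>)
  have "sat_hyperqptl T (\<Pi>(\<pi> \<mapsto> t)) \<Theta> i \<phi> \<longleftrightarrow> sat_hyperqptl T (\<Pi>'(\<pi> \<mapsto> t)) \<Theta>' i \<phi>" for t
    by (rule ExistsTrace.IH) (use ExistsTrace.prems in simp_all)
  then show ?case by simp
next
  case (ExistsProp q \<phi>)
  have "sat_hyperqptl T \<Pi> (\<Theta>(q \<mapsto> t)) i \<phi> \<longleftrightarrow> sat_hyperqptl T \<Pi>' (\<Theta>'(q \<mapsto> t)) i \<phi>" for t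
    by (rule ExistsProp.IH) (use ExistsProp.prems in simp_all)
  then show ?case by simp
next
  case (ForallProp q \<phi>)
  have "sat_hyperqptl T \<Pi> (\<Theta>(q \<mapsto> t)) i \<phi> \<longleftrightarrow> sat_hyperqptl T \<Pi>' (\<Theta>'(q \<mapsto> t)) i \<phi>" for t
    by (rule ForallProp.IH) (use ForallProp.prems in simp_all)
  then show ?case by simp
next
  case (Body \<psi>)
  then show ?case using sat_qptl_cong[of \<psi> \<Pi> \<Pi>' \<Theta> \<Theta>'] by simp
qed

definition mark_below :: "nat \<Rightarrow> nat \<Rightarrow> track set" where
  "mark_below n = (\<lambda>i. if i < n then {Marker} else {})"

text \<open>Raising the cardinality by one amounts to prepending one letter, the operation under
  which colourings are stable.\<close>

lemma mark_below_Suc: "mark_below (Suc n) = case_nat {Marker} (mark_below n)"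
  by (auto simp: mark_below_def fun_eq_iff split: nat.splits)

lemma card_marked_below:
  "finite (marked (mark_below n) :: 'a trace set)" "card (marked (mark_below n) :: 'a trace set) = n"
proof -
  have "inj (singleton_trace :: nat \<Rightarrow> 'a trace)"
    by (auto simp: inj_def singleton_trace_def fun_eq_iff split: if_splits)
  moreover have "marked (mark_below n) = (singleton_trace ` {..<n} :: 'a trace set)"
    by (auto simp: marked_def mark_below_def)
  ultimately show "finite (marked (mark_below n) :: 'a trace set)"
    "card (marked (mark_below n) :: 'a trace set) = n"
    by (auto simp: card_image inj_on_subset)
qed

text \<open>By the pigeonhole principle two words \<open>mark_below n\<close> and
  \<open>mark_below m\<close> share a colour, and prepending the same letters to both keeps the
  colours equal; \<open>m - n\<close> is then a period.\<close>

lemma hyperqptl_ultimately_periodic: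
  fixes \<phi> :: "'a hyperqptl"
  assumes "closed_hyperqptl \<phi>"
  shows "\<exists>n d. d > 0 \<and> (\<forall>k\<ge>n. marked (mark_below k) \<Turnstile>\<^sub>Q \<phi> \<longleftrightarrow> marked (mark_below (k + d)) \<Turnstile>\<^sub>Q \<phi>)"
proof -
  obtain c :: "_ \<Rightarrow> nat" where c: "colouring c {w. word_sat w \<phi>}"
    using colourable_hyperqptl[of \<phi>] unfolding colourable_def by blast
  have "finite (range (\<lambda>n. c (mark_below n)))"
    using colouringD(1)[OF c] by (rule rev_finite_subset) auto
  then have "\<not> inj (\<lambda>n. c (mark_below n))" using finite_imageD infinite_UNIV_nat by blast
  then obtain n m where nm: "n < m" "c (mark_below n) = c (mark_below m)"
    by (metis injI linorder_neqE_nat)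
  have "c (mark_below (n + j)) = c (mark_below (m + j))" for j
    by (induction j) (auto simp: nm mark_below_Suc intro: colouringD(2)[OF c])
  then have "word_sat (mark_below (n + j)) \<phi> \<longleftrightarrow> word_sat (mark_below (m + j)) \<phi>" for j
    using colouringD(3)[OF c] by blast
  moreover have "word_sat w \<phi> \<longleftrightarrow> marked w \<Turnstile>\<^sub>Q \<phi>" for w
    unfolding models_hyperqptl_def using assms
    by (intro sat_hyperqptl_cong) (auto simp: closed_hyperqptl_def)
  ultimately have *: "marked (mark_below (n + j)) \<Turnstile>\<^sub>Q \<phi> \<longleftrightarrow> marked (mark_below (m + j)) \<Turnstile>\<^sub>Q \<phi>" for j
    by blast
  have "marked (mark_below k) \<Turnstile>\<^sub>Q \<phi> \<longleftrightarrow> marked (mark_below (k + (m - n))) \<Turnstile>\<^sub>Q \<phi>" if "k \<ge> n" for k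
    using *[of "k - n"] that nm(1) by (simp add: add.commute)
  moreover have "m - n > 0" using nm(1) by simp
  ultimately show ?thesis by blast
qed

theorem theorem2:
  "(\<forall>\<phi> :: 'a hyperqptl. closed_hyperqptl \<phi> \<longrightarrow>
      (\<exists>\<psi> :: 'a s1se. closed_s1se \<psi> \<and> (\<forall>T :: 'a trace set. T \<Turnstile>\<^sub>Q \<phi> \<longleftrightarrow> T \<Turnstile>\<^sub>S \<psi>))) \<and>
   (\<exists>\<psi> :: 'a s1se. closed_s1se \<psi> \<and>
      \<not> (\<exists>\<phi> :: 'a hyperqptl. closed_hyperqptl \<phi> \<and> (\<forall>T :: 'a trace set. T \<Turnstile>\<^sub>Q \<phi> \<longleftrightarrow> T \<Turnstile>\<^sub>S \<psi>)))"
proof -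
  have False if cl: "closed_hyperqptl \<phi>" and eq: "\<And>T :: 'a trace set. T \<Turnstile>\<^sub>Q \<phi> \<longleftrightarrow> T \<Turnstile>\<^sub>S square_card"
    for \<phi> :: "'a hyperqptl"
  proof -
    obtain n d where d: "d > 0" and per: "\<And>k. k \<ge> n \<Longrightarrow>
        marked (mark_below k) \<Turnstile>\<^sub>Q \<phi> \<longleftrightarrow> marked (mark_below (k + d)) \<Turnstile>\<^sub>Q \<phi>"
      using hyperqptl_ultimately_periodic[OF cl] by blast
    have sq: "marked (mark_below k) \<Turnstile>\<^sub>Q \<phi> \<longleftrightarrow> (\<exists>j. k = j\<^sup>2)" for k
      by (simp add: eq models_square_card card_marked_below)
    \<comment> \<open>The square of \<open>n + d\<close> lies in the periodic range, and the gap to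
      the next square, \<open>2 * (n + d) + 1\<close>, exceeds the period \<open>d\<close>. Adding
      \<open>d\<close> therefore lands strictly between consecutive squares.\<close>
    have "n + d \<le> (n + d)\<^sup>2" unfolding power2_eq_square by (rule le_square)
    then have "n \<le> (n + d)\<^sup>2" by simp
    then obtain j where j: "(n + d)\<^sup>2 + d = j\<^sup>2" using per[of "(n + d)\<^sup>2"] unfolding sq by blast
    then have "(n + d)\<^sup>2 < j\<^sup>2" using d by linarith
    moreover have "j\<^sup>2 < (Suc (n + d))\<^sup>2"
      unfolding j[symmetric] by (simp add: power2_eq_square)
    ultimately have "n + d < j" "j < Suc (n + d)" by (auto dest: power_less_imp_less_base)
    then show False by simp
  qed
  then have "\<not> (\<exists>\<phi> :: 'a hyperqptl. closed_hyperqptl \<phi> \<and>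
      (\<forall>T :: 'a trace set. T \<Turnstile>\<^sub>Q \<phi> \<longleftrightarrow> T \<Turnstile>\<^sub>S square_card))" by blast
  with hyperqptl_imp_s1se closed_square_card show ?thesis by blast
qed

end
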